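(* For all $x, x_0, \rho, \rho_0>0$ the following two estimates hold: $$|H(x,\rho)-H(x_0,\rho)|\le \pi\min\left(\frac1{\rho^2},\frac{\pi}{2\rho}\right)|x-x_0|,$$ $$|H(x,\rho)-H(x,\rho_0)|\le \min\left(\frac{\rho+\rho_0}{\rho\rho_0},\pi\right)\frac{|\rho-\rho_0|}{\rho_0\rho}.$$
   Context: The restricted Good function is defined for $x\in\mathbb R$ and $\rho>0$ by $$H(x,\rho):=\frac1\pi\int_0^\pi\frac{\cos\big(x(\theta+\sin\theta)\big)}{\rho^2+\sin^2\theta}\,d\theta .$$ *)

theory Defs
  imports "HOL-Analysis.Analysis"
begin

text \<open>The restricted Good function; it is only meaningful for \<open>\<rho> > 0\<close>, where the integrand is
  continuous on \<open>[0, \<pi>]\<close>.\<close>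

definition good_H :: "real \<Rightarrow> real \<Rightarrow> real" where
  "good_H x \<rho> =
     1 / pi * integral {0..pi} (\<lambda>\<theta>. cos (x * (\<theta> + sin \<theta>)) / (\<rho>\<^sup>2 + (sin \<theta>)\<^sup>2))"

end

theory Submission
  imports Defs
begin

text \<open>Both estimates bound the integrand pointwise by a multiple of the kernel
  \<open>1 / (\<rho>\<^sup>2 + sin\<^sup>2 \<theta>)\<close> (or of a product of two such kernels). The kernel is at most \<open>1 / \<rho>\<^sup>2\<close>,
  while Jordan's inequality \<open>sin \<theta> \<ge> 2\<theta>/\<pi>\<close> on \<open>[0, \<pi>/2]\<close> and the symmetry \<open>\<theta> \<mapsto> \<pi> - \<theta>\<close> bound its
  integral over \<open>[0, \<pi>]\<close> by \<open>(\<pi>/\<rho>) arctan (1/\<rho>) \<le> \<pi>\<^sup>2 / (2\<rho>)\<close>; these two bounds produce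
  the two entries of each minimum.\<close>

text \<open>Sine is concave on \<open>{0..pi}\<close>, so on \<open>[0, pi/2]\<close> its graph lies
  above the chord from \<open>(0, 0)\<close> to \<open>(pi/2, 1)\<close>. The weight
  \<open>2 * t / pi\<close> writes \<open>t\<close> as a convex combination of the
  endpoints.\<close>

lemma jordan_sin_ge:
  fixes t :: real
  assumes "0 \<le> t" "t \<le> pi / 2"
  shows "2 * t / pi \<le> sin t"
proof -
  have "convex_on {0..pi} (\<lambda>x. - sin x)"
    by (rule f''_ge0_imp_convex[where f' = "\<lambda>x. - cos x" and f'' = sin])
      (auto intro!: derivative_eq_intros sin_ge_zero)
  from convex_onD[OF this, of "2 * t / pi" 0 "pi / 2"] assms
  show ?thesis
    by (simp add: field_simps)
qed

lemma abs_cos_diff_le: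
  fixes a b :: real
  shows "\<bar>cos a - cos b\<bar> \<le> \<bar>a - b\<bar>"
proof -
  have "\<bar>cos a - cos b\<bar> = 2 * \<bar>sin ((a + b) / 2)\<bar> * \<bar>sin ((b - a) / 2)\<bar>"
    by (simp add: cos_diff_cos abs_mult)
  also have "\<dots> \<le> 2 * 1 * \<bar>(b - a) / 2\<bar>"
    by (intro mult_mono abs_sin_le_one abs_sin_x_le_abs_x) auto
  finally show ?thesis by simp
qed

text \<open>By symmetry \<open>sin t = sin (pi - t)\<close>, which is at most \<open>pi - t\<close>.
  This caps the factor multiplying \<open>x\<close> inside the cosine and so gives the Lipschitz
  constant of the integrand in \<open>x\<close>.\<close>

lemma add_sin_le_pi:
  fixes t :: real
  assumes "t \<le> pi"
  shows "t + sin t \<le> pi"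
  using sin_x_le_x[of "pi - t"] assms by simp

lemma continuous_on_good_kernel:
  fixes \<rho> :: real
  assumes "\<rho> > 0" "continuous_on A f"
  shows "continuous_on A (\<lambda>\<theta>. f \<theta> / (\<rho>\<^sup>2 + (sin \<theta>)\<^sup>2))"
  using assms by (intro continuous_intros) (auto simp: add_pos_nonneg less_imp_neq[symmetric])

lemma integral_good_kernel_half_le:
  fixes \<rho> :: real
  assumes "\<rho> > 0"
  shows "integral {0..pi / 2} (\<lambda>\<theta>. 1 / (\<rho>\<^sup>2 + (sin \<theta>)\<^sup>2)) \<le> pi\<^sup>2 / (4 * \<rho>)"
proof -
  have pos: "\<rho>\<^sup>2 + u\<^sup>2 > 0" for u :: real
    using assms by (simp add: add_pos_nonneg)
  \<comment> \<open>An antiderivative of the comparison kernel in which \<open>sin \<theta>\<close>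
    is replaced by its Jordan lower bound \<open>2 * \<theta> / pi\<close>; at \<open>pi / 2\<close>
    the argument of \<open>arctan\<close> becomes \<open>1 / \<rho>\<close>.\<close>
  define F where "F \<theta> = pi / (2 * \<rho>) * arctan (2 * \<theta> / (pi * \<rho>))" for \<theta> :: real
  have deriv: "(F has_vector_derivative 1 / (\<rho>\<^sup>2 + (2 * \<theta> / pi)\<^sup>2)) (at \<theta> within A)" for \<theta> A
  proof -
    have "(F has_real_derivative
        pi / (2 * \<rho>) * (inverse (1 + (2 * \<theta> / (pi * \<rho>))\<^sup>2) * (2 / (pi * \<rho>)))) (at \<theta> within A)"
      unfolding F_def using assms by (auto intro!: derivative_eq_intros)
    moreover have "pi / (2 * \<rho>) * (inverse (1 + (2 * \<theta> / (pi * \<rho>))\<^sup>2) * (2 / (pi * \<rho>)))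
        = 1 / (\<rho>\<^sup>2 + (2 * \<theta> / pi)\<^sup>2)"
    proof -
      have "1 + (2 * \<theta> / (pi * \<rho>))\<^sup>2 = (\<rho>\<^sup>2 + (2 * \<theta> / pi)\<^sup>2) / \<rho>\<^sup>2"
        using assms by (simp add: field_simps power2_eq_square)
      then show ?thesis
        using assms pos[of "2 * \<theta> / pi"] by (simp add: power2_eq_square)
    qed
    ultimately show ?thesis
      by (simp add: has_real_derivative_iff_has_vector_derivative)
  qed
  have int: "((\<lambda>\<theta>. 1 / (\<rho>\<^sup>2 + (2 * \<theta> / pi)\<^sup>2)) has_integral F (pi / 2) - F 0) {0..pi / 2}"
    by (rule fundamental_theorem_of_calculus) (auto intro: deriv)
  have "integral {0..pi / 2} (\<lambda>\<theta>. 1 / (\<rho>\<^sup>2 + (sin \<theta>)\<^sup>2))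
      \<le> integral {0..pi / 2} (\<lambda>\<theta>. 1 / (\<rho>\<^sup>2 + (2 * \<theta> / pi)\<^sup>2))"
  proof (rule integral_le)
    show "(\<lambda>\<theta>. 1 / (\<rho>\<^sup>2 + (sin \<theta>)\<^sup>2)) integrable_on {0..pi / 2}"
      using assms by (intro integrable_continuous_real continuous_on_good_kernel continuous_intros)
    show "(\<lambda>\<theta>. 1 / (\<rho>\<^sup>2 + (2 * \<theta> / pi)\<^sup>2)) integrable_on {0..pi / 2}"
      using int by (rule has_integral_integrable)
    fix \<theta> assume "\<theta> \<in> {0..pi / 2}"
    then have "(2 * \<theta> / pi)\<^sup>2 \<le> (sin \<theta>)\<^sup>2"
      by (intro power_mono jordan_sin_ge) auto
    then show "1 / (\<rho>\<^sup>2 + (sin \<theta>)\<^sup>2) \<le> 1 / (\<rho>\<^sup>2 + (2 * \<theta> / pi)\<^sup>2)"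
      using pos[of "2 * \<theta> / pi"] by (intro divide_left_mono mult_pos_pos pos) auto
  qed
  also have "\<dots> = pi / (2 * \<rho>) * arctan (1 / \<rho>)"
    using integral_unique[OF int] by (simp add: F_def)
  also have "\<dots> \<le> pi / (2 * \<rho>) * (pi / 2)"
    using assms arctan_ubound[of "1 / \<rho>"] by (intro mult_left_mono) auto
  finally show ?thesis
    by (simp add: power2_eq_square)
qed

lemma integral_good_kernel_le:
  fixes \<rho> :: real
  assumes "\<rho> > 0"
  shows "integral {0..pi} (\<lambda>\<theta>. 1 / (\<rho>\<^sup>2 + (sin \<theta>)\<^sup>2)) \<le> pi\<^sup>2 / (2 * \<rho>)"
proof -
  let ?k = "\<lambda>\<theta>. 1 / (\<rho>\<^sup>2 + (sin \<theta>)\<^sup>2)"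
  have "(?k has_integral integral {pi / 2..pi} ?k) {pi / 2..pi}"
    using assms by (intro integrable_integral integrable_continuous_real
      continuous_on_good_kernel continuous_intros)
  \<comment> \<open>The kernel depends only on the square of the sine, so it is even with period
    \<open>pi\<close>. Shifting by \<open>pi\<close> moves the right half to
    \<open>[-pi/2, 0]\<close>, and reflection then carries it to the left half.\<close>
  then have "((\<lambda>\<theta>. ?k (\<theta> + pi)) has_integral integral {pi / 2..pi} ?k) {- (pi / 2)..- 0}"
    using has_integral_affinity'[of ?k "integral {pi / 2..pi} ?k" "pi / 2" pi 1 pi] by simp
  then have half: "integral {pi / 2..pi} ?k = integral {0..pi / 2} ?k"
    using Henstock_Kurzweil_Integration.integral_reflect_real[of "pi / 2" 0 ?k] by (simp add: integral_unique)
  have "integral {0..pi} ?k = integral {0..pi / 2} ?k + integral {pi / 2..pi} ?k"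
    using assms
    by (intro Henstock_Kurzweil_Integration.integral_combine[symmetric]
        integrable_continuous_real continuous_on_good_kernel continuous_intros) auto
  then show ?thesis
    using integral_good_kernel_half_le[OF assms] half by (simp add: field_simps)
qed

text \<open>Reduces both estimates to pointwise domination of integrands. Both parameters may
  change, so that one statement covers variation in \<open>x\<close> and in
  \<open>\<rho>\<close>.\<close>

lemma abs_good_H_diff_le:
  assumes "\<rho> > 0" "\<rho>' > 0" and "k integrable_on {0..pi}"
    and "\<And>\<theta>. \<theta> \<in> {0..pi} \<Longrightarrow>
      \<bar>cos (x * (\<theta> + sin \<theta>)) / (\<rho>\<^sup>2 + (sin \<theta>)\<^sup>2) - cos (x' * (\<theta> + sin \<theta>)) / (\<rho>'\<^sup>2 + (sin \<theta>)\<^sup>2)\<bar> \<le> k \<theta>"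
  shows "\<bar>good_H x \<rho> - good_H x' \<rho>'\<bar> \<le> integral {0..pi} k / pi"
proof -
  let ?f = "\<lambda>x \<rho> \<theta>. cos (x * (\<theta> + sin \<theta>)) / (\<rho>\<^sup>2 + (sin \<theta>)\<^sup>2)"
  have int: "?f y r integrable_on {0..pi}" if "r > 0" for y r
    using that by (intro integrable_continuous_real continuous_on_good_kernel continuous_intros)
  have "\<bar>good_H x \<rho> - good_H x' \<rho>'\<bar> = \<bar>integral {0..pi} (\<lambda>\<theta>. ?f x \<rho> \<theta> - ?f x' \<rho>' \<theta>)\<bar> / pi"
    using assms(1,2)
    by (simp add: good_H_def Henstock_Kurzweil_Integration.integral_diff int flip: diff_divide_distrib)
  also have "\<dots> \<le> integral {0..pi} k / pi"
    using assms(3,4) integral_norm_bound_integral[OF integrable_diff[OF int int], of \<rho> \<rho>' k x x'] assms(1,2)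
    by (intro divide_right_mono) auto
  finally show ?thesis .
qed

text \<open>Over the common denominator the numerator is \<open>b\<^sup>2 - a\<^sup>2\<close>, which
  factors; this is the source of \<open>\<bar>\<rho> - \<rho>\<^sub>0\<bar> * (\<rho> +
  \<rho>\<^sub>0)\<close> in the second estimate.\<close>

lemma good_kernel_diff:
  fixes a b s :: real
  assumes "a > 0" "b > 0"
  shows "\<bar>1 / (a\<^sup>2 + s\<^sup>2) - 1 / (b\<^sup>2 + s\<^sup>2)\<bar> = \<bar>a - b\<bar> * (a + b) / ((a\<^sup>2 + s\<^sup>2) * (b\<^sup>2 + s\<^sup>2))"
proof -
  have pos: "a\<^sup>2 + s\<^sup>2 > 0" "b\<^sup>2 + s\<^sup>2 > 0"
    using assms by (simp_all add: add_pos_nonneg)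
  then have "a\<^sup>2 + s\<^sup>2 \<noteq> 0" "b\<^sup>2 + s\<^sup>2 \<noteq> 0"
    by linarith+
  from diff_frac_eq[OF this, of 1 1]
  have "1 / (a\<^sup>2 + s\<^sup>2) - 1 / (b\<^sup>2 + s\<^sup>2) = (b - a) * (a + b) / ((a\<^sup>2 + s\<^sup>2) * (b\<^sup>2 + s\<^sup>2))"
    by (simp add: power2_eq_square algebra_simps)
  then show ?thesis
    using assms pos by (simp add: abs_mult abs_minus_commute)
qed

theorem proposition1p1:
  fixes x x\<^sub>0 \<rho> \<rho>\<^sub>0 :: real
  assumes "x > 0" and "x\<^sub>0 > 0" and "\<rho> > 0" and "\<rho>\<^sub>0 > 0"
  shows "\<bar>good_H x \<rho> - good_H x\<^sub>0 \<rho>\<bar> \<le> pi * min (1 / \<rho>\<^sup>2) (pi / (2 * \<rho>)) * \<bar>x - x\<^sub>0\<bar>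
       \<and> \<bar>good_H x \<rho> - good_H x \<rho>\<^sub>0\<bar>
           \<le> min ((\<rho> + \<rho>\<^sub>0) / (\<rho> * \<rho>\<^sub>0)) pi * (\<bar>\<rho> - \<rho>\<^sub>0\<bar> / (\<rho>\<^sub>0 * \<rho>))"
proof
  let ?k = "\<lambda>r \<theta>. 1 / (r\<^sup>2 + (sin \<theta>)\<^sup>2)"
  have int: "?k r integrable_on {0..pi}" if "r > 0" for r
    using that by (intro integrable_continuous_real continuous_on_good_kernel continuous_intros)
  have k0: "0 < ?k r \<theta>" if "r > 0" for r \<theta> :: real
    using that by (simp add: add_pos_nonneg)
  have k1: "?k r \<theta> \<le> 1 / r\<^sup>2" if "r > 0" for r \<theta> :: real
    using that by (intro divide_left_mono mult_pos_pos) (auto simp: add_pos_nonneg)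

  have "integral {0..pi} (?k \<rho>) \<le> integral {0..pi} (\<lambda>_. 1 / \<rho>\<^sup>2)"
    using assms by (intro integral_le int k1) auto
  then have K: "integral {0..pi} (?k \<rho>) \<le> pi * min (1 / \<rho>\<^sup>2) (pi / (2 * \<rho>))"
    using integral_good_kernel_le[OF \<open>\<rho> > 0\<close>] by (simp add: min_def power2_eq_square)
  \<comment> \<open>The factor \<open>pi\<close> bounds \<open>\<theta> + sin \<theta>\<close>; it
    cancels the normalisation \<open>1 / pi\<close>, so the \<open>pi\<close> in the final constant
    comes from the kernel integral alone.\<close>
  have "\<bar>good_H x \<rho> - good_H x\<^sub>0 \<rho>\<bar> \<le> integral {0..pi} (\<lambda>\<theta>. pi * \<bar>x - x\<^sub>0\<bar> * ?k \<rho> \<theta>) / pi"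
  proof (rule abs_good_H_diff_le[OF \<open>\<rho> > 0\<close> \<open>\<rho> > 0\<close>])
    fix \<theta> assume \<theta>: "\<theta> \<in> {0..pi}"
    let ?u = "\<theta> + sin \<theta>"
    have u: "0 \<le> ?u" "?u \<le> pi"
      using \<theta> by (auto intro: add_nonneg_nonneg sin_ge_zero add_sin_le_pi)
    have "\<bar>cos (x * ?u) - cos (x\<^sub>0 * ?u)\<bar> \<le> \<bar>x * ?u - x\<^sub>0 * ?u\<bar>"
      by (rule abs_cos_diff_le)
    also have "\<dots> = ?u * \<bar>x - x\<^sub>0\<bar>"
      using u by (simp add: abs_mult flip: left_diff_distrib)
    also have "\<dots> \<le> pi * \<bar>x - x\<^sub>0\<bar>"
      using u by (intro mult_right_mono) auto
    finally have "\<bar>cos (x * ?u) - cos (x\<^sub>0 * ?u)\<bar> * ?k \<rho> \<theta> \<le> pi * \<bar>x - x\<^sub>0\<bar> * ?k \<rho> \<theta>"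
      using k0[OF \<open>\<rho> > 0\<close>, of \<theta>] by (intro mult_right_mono) auto
    then show "\<bar>cos (x * ?u) / (\<rho>\<^sup>2 + (sin \<theta>)\<^sup>2) - cos (x\<^sub>0 * ?u) / (\<rho>\<^sup>2 + (sin \<theta>)\<^sup>2)\<bar>
        \<le> pi * \<bar>x - x\<^sub>0\<bar> * ?k \<rho> \<theta>"
      using k0[OF \<open>\<rho> > 0\<close>, of \<theta>] by (simp add: flip: diff_divide_distrib)
  qed (use assms in \<open>intro integrable_on_mult_right int\<close>)
  also have "\<dots> = integral {0..pi} (?k \<rho>) * \<bar>x - x\<^sub>0\<bar>"
    unfolding integral_mult_right by simp
  also have "\<dots> \<le> pi * min (1 / \<rho>\<^sup>2) (pi / (2 * \<rho>)) * \<bar>x - x\<^sub>0\<bar>"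
    using K by (intro mult_right_mono) auto
  finally show "\<bar>good_H x \<rho> - good_H x\<^sub>0 \<rho>\<bar> \<le> pi * min (1 / \<rho>\<^sup>2) (pi / (2 * \<rho>)) * \<bar>x - x\<^sub>0\<bar>" .

  \<comment> \<open>Only \<open>\<bar>cos\<bar> \<le> 1\<close> is used, so there is no dependence
    on \<open>x\<close> in the bound.\<close>
  have pt: "\<bar>cos (x * u) / (\<rho>\<^sup>2 + (sin \<theta>)\<^sup>2) - cos (x * u) / (\<rho>\<^sub>0\<^sup>2 + (sin \<theta>)\<^sup>2)\<bar>
      \<le> \<bar>\<rho> - \<rho>\<^sub>0\<bar> * ((\<rho> + \<rho>\<^sub>0) * (?k \<rho> \<theta> * ?k \<rho>\<^sub>0 \<theta>))" for u \<theta>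
  proof -
    have "\<bar>cos (x * u) / (\<rho>\<^sup>2 + (sin \<theta>)\<^sup>2) - cos (x * u) / (\<rho>\<^sub>0\<^sup>2 + (sin \<theta>)\<^sup>2)\<bar>
        = \<bar>cos (x * u)\<bar> * \<bar>?k \<rho> \<theta> - ?k \<rho>\<^sub>0 \<theta>\<bar>"
      by (simp add: right_diff_distrib flip: abs_mult)
    also have "\<dots> \<le> 1 * \<bar>?k \<rho> \<theta> - ?k \<rho>\<^sub>0 \<theta>\<bar>"
      by (intro mult_right_mono) auto
    finally show ?thesis
      using good_kernel_diff[of \<rho> \<rho>\<^sub>0 "sin \<theta>"] assms by simp
  qed
  \<comment> \<open>First entry of the minimum: both kernels are replaced by their constant bounds,
    and the interval length \<open>pi\<close> cancels \<open>1 / pi\<close>.\<close>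
  have A: "\<bar>good_H x \<rho> - good_H x \<rho>\<^sub>0\<bar>
      \<le> integral {0..pi} (\<lambda>_. \<bar>\<rho> - \<rho>\<^sub>0\<bar> * ((\<rho> + \<rho>\<^sub>0) * (1 / \<rho>\<^sup>2 * (1 / \<rho>\<^sub>0\<^sup>2)))) / pi"
  proof (rule abs_good_H_diff_le[OF \<open>\<rho> > 0\<close> \<open>\<rho>\<^sub>0 > 0\<close> _ order_trans[OF pt]])
    fix \<theta> :: real
    show "\<bar>\<rho> - \<rho>\<^sub>0\<bar> * ((\<rho> + \<rho>\<^sub>0) * (?k \<rho> \<theta> * ?k \<rho>\<^sub>0 \<theta>))
        \<le> \<bar>\<rho> - \<rho>\<^sub>0\<bar> * ((\<rho> + \<rho>\<^sub>0) * (1 / \<rho>\<^sup>2 * (1 / \<rho>\<^sub>0\<^sup>2)))"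
      using assms k0 by (intro mult_left_mono mult_mono k1) (auto intro: less_imp_le)
  qed auto
  \<comment> \<open>Second entry: after distributing \<open>\<rho> + \<rho>\<^sub>0\<close>, each
    summand \<open>r\<close> absorbs the kernel with the same parameter via
    \<open>r * ?k r \<theta> \<le> 1 / r\<close>, which leaves a single kernel to integrate.\<close>
  have "\<bar>good_H x \<rho> - good_H x \<rho>\<^sub>0\<bar>
      \<le> integral {0..pi} (\<lambda>\<theta>. \<bar>\<rho> - \<rho>\<^sub>0\<bar> * (1 / \<rho> * ?k \<rho>\<^sub>0 \<theta> + 1 / \<rho>\<^sub>0 * ?k \<rho> \<theta>)) / pi"
  proof (rule abs_good_H_diff_le[OF \<open>\<rho> > 0\<close> \<open>\<rho>\<^sub>0 > 0\<close> _ order_trans[OF pt]])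
    fix \<theta> :: real
    have r: "r * ?k r \<theta> \<le> 1 / r" if "r > 0" for r
      using mult_left_mono[OF k1[OF that, of \<theta>], of r] that by (simp add: power2_eq_square)
    have "(\<rho> + \<rho>\<^sub>0) * (?k \<rho> \<theta> * ?k \<rho>\<^sub>0 \<theta>) = \<rho> * ?k \<rho> \<theta> * ?k \<rho>\<^sub>0 \<theta> + \<rho>\<^sub>0 * ?k \<rho>\<^sub>0 \<theta> * ?k \<rho> \<theta>"
      by (simp add: algebra_simps add_divide_distrib)
    also have "\<dots> \<le> 1 / \<rho> * ?k \<rho>\<^sub>0 \<theta> + 1 / \<rho>\<^sub>0 * ?k \<rho> \<theta>"
      using assms by (intro add_mono mult_right_mono r less_imp_le[OF k0])
    finally show "\<bar>\<rho> - \<rho>\<^sub>0\<bar> * ((\<rho> + \<rho>\<^sub>0) * (?k \<rho> \<theta> * ?k \<rho>\<^sub>0 \<theta>))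
        \<le> \<bar>\<rho> - \<rho>\<^sub>0\<bar> * (1 / \<rho> * ?k \<rho>\<^sub>0 \<theta> + 1 / \<rho>\<^sub>0 * ?k \<rho> \<theta>)"
      by (intro mult_left_mono) auto
  qed (use assms in \<open>intro integrable_on_mult_right integrable_add int\<close>)
  also have "\<dots> = \<bar>\<rho> - \<rho>\<^sub>0\<bar> * (1 / \<rho> * integral {0..pi} (?k \<rho>\<^sub>0) + 1 / \<rho>\<^sub>0 * integral {0..pi} (?k \<rho>)) / pi"
    unfolding integral_mult_right using assms
    by (subst Henstock_Kurzweil_Integration.integral_add)
      (auto intro!: integrable_on_mult_right int simp only: integral_mult_right)
  \<comment> \<open>The two summands become equal, each
    \<open>pi\<^sup>2 / (2 * \<rho> * \<rho>\<^sub>0)\<close>; their sum divided by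
    \<open>pi\<close> gives the constant \<open>pi\<close>.\<close>
  also have "\<dots> \<le> \<bar>\<rho> - \<rho>\<^sub>0\<bar> * (1 / \<rho> * (pi\<^sup>2 / (2 * \<rho>\<^sub>0)) + 1 / \<rho>\<^sub>0 * (pi\<^sup>2 / (2 * \<rho>))) / pi"
    using assms
    by (intro divide_right_mono mult_left_mono add_mono integral_good_kernel_le) auto
  also have "\<dots> = pi * (\<bar>\<rho> - \<rho>\<^sub>0\<bar> / (\<rho>\<^sub>0 * \<rho>))"
    using assms by (simp add: field_simps power2_eq_square)
  finally have B: "\<bar>good_H x \<rho> - good_H x \<rho>\<^sub>0\<bar> \<le> pi * (\<bar>\<rho> - \<rho>\<^sub>0\<bar> / (\<rho>\<^sub>0 * \<rho>))" .
  have "integral {0..pi} (\<lambda>_. \<bar>\<rho> - \<rho>\<^sub>0\<bar> * ((\<rho> + \<rho>\<^sub>0) * (1 / \<rho>\<^sup>2 * (1 / \<rho>\<^sub>0\<^sup>2)))) / pi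
      = (\<rho> + \<rho>\<^sub>0) / (\<rho> * \<rho>\<^sub>0) * (\<bar>\<rho> - \<rho>\<^sub>0\<bar> / (\<rho>\<^sub>0 * \<rho>))"
    using assms by (simp add: power2_eq_square ac_simps)
  with A B show "\<bar>good_H x \<rho> - good_H x \<rho>\<^sub>0\<bar>
      \<le> min ((\<rho> + \<rho>\<^sub>0) / (\<rho> * \<rho>\<^sub>0)) pi * (\<bar>\<rho> - \<rho>\<^sub>0\<bar> / (\<rho>\<^sub>0 * \<rho>))"
    by (simp add: min_def)
qed

end
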